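(* $5n-O(\log n)$ bits are necessary and sufficient for an encoding answering range maximum queries on a $2\times n$ array: every encoding requires at least $5n-O(\log n)$ bits in the worst case over input arrays, and there is an encoding using at most $5n-O(\log n)$ bits for every input array.
   Context: All logarithms are to base 2. The input is a $2\times n$ array $A$ of elements from a totally ordered set, all entries distinct (identical entries are ordered lexicographically by index). A range maximum query is: given $q=[i_1\cdots i_2]\times[j_1\cdots j_2]$ with $1\le i_1\le i_2\le 2$ (rows) and $1\le j_1\le j_2\le n$ (columns), return $\mathrm{argmax}_{(i,j)\in q}A[i,j]$, the position of the maximum in the range. An encoding maps each array (of known dimensions) to a bit string so that all queries can be answered from the bit string alone, without access to $A$. Here $O(\log n)$ denotes a nonnegative quantity bounded by a constant times $\log n$ (for $n\ge 2$); it need not be the same in the two bounds. *)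

theory Defs
  imports Complex_Main "HOL-Library.FuncSet"
begin

definition cells :: "nat \<Rightarrow> (nat \<times> nat) set" where
  "cells n = {1..2} \<times> {1..n}"

text \<open>Arrays are extensional functions on the cells (row, column), so that two arrays with the
  same entries are equal and an encoding cannot depend on values outside the array.\<close>

definition arrays :: "nat \<Rightarrow> (nat \<times> nat \<Rightarrow> 'a::linorder) set" where
  "arrays n = {A \<in> cells n \<rightarrow>\<^sub>E UNIV. inj_on A (cells n)}"

definition queries :: "nat \<Rightarrow> (nat \<times> nat) set set" where
  "queries n = {{i\<^sub>1..i\<^sub>2} \<times> {j\<^sub>1..j\<^sub>2} | i\<^sub>1 i\<^sub>2 j\<^sub>1 j\<^sub>2.
     1 \<le> i\<^sub>1 \<and> i\<^sub>1 \<le> i\<^sub>2 \<and> i\<^sub>2 \<le> 2 \<and> 1 \<le> j\<^sub>1 \<and> j\<^sub>1 \<le> j\<^sub>2 \<and> j\<^sub>2 \<le> n}"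

text \<open>The maximum is attained at a unique position of a query, as the entries are distinct and
  queries are finite and nonempty; hence \<^const>\<open>arg_max_on\<close> makes no arbitrary choice here.\<close>

definition rmq :: "(nat \<times> nat \<Rightarrow> 'a::linorder) \<Rightarrow> (nat \<times> nat) set \<Rightarrow> nat \<times> nat" where
  "rmq A q = arg_max_on A q"

text \<open>The decoder sees only the bit string and the query; it is chosen after \<open>n\<close>, so the
  dimensions are known to it.\<close>

definition rmq_encoding :: "nat \<Rightarrow> ((nat \<times> nat \<Rightarrow> 'a::linorder) \<Rightarrow> bool list) \<Rightarrow> bool" where
  "rmq_encoding n enc \<longleftrightarrow>
     (\<exists>dec :: bool list \<Rightarrow> (nat \<times> nat) set \<Rightarrow> nat \<times> nat.
        \<forall>A\<in>arrays n. \<forall>q\<in>queries n. dec (enc A) q = rmq A q)"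

definition nonneg_O_log :: "(nat \<Rightarrow> real) \<Rightarrow> bool" where
  "nonneg_O_log f \<longleftrightarrow> (\<exists>c. \<forall>n\<ge>2. 0 \<le> f n \<and> f n \<le> c * log 2 (real n))"

end

theory Submission
  imports Defs "HOL-Library.Tree"
begin

text \<open>The answers to all queries amount to the Cartesian trees of the two rows together with, for
  each node of the joint Cartesian tree in preorder, the row that contains the maximum: this row
  and the row trees locate the maximum, whose column then splits the array in two. Conversely,
  every choice of two tree shapes and \<open>n\<close> rows occurs. By induction, the parts to the left and to
  the right of the joint maximum can be realized; the other row can be given its prescribed tree
  because the relative order of values of the left part and values of the right part is still
  free. Hence there are exactly \<open>C\<^sub>n\<^sup>2 \<cdot> 2\<^sup>n\<close> answer patterns, where the Catalan number \<open>C\<^sub>n\<close> lies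
  between \<open>4\<^sup>n / (2 n (n + 1))\<close> and \<open>4\<^sup>n\<close>.\<close>

section \<open>Cartesian trees of strips\<close>

text \<open>A relation instead of \<open>arg_max_on\<close>, so that no default value enters: on an
  empty set, or where the largest value is attained twice, no position satisfies it.\<close>

definition smax :: "('p \<Rightarrow> 'b::linorder) \<Rightarrow> 'p set \<Rightarrow> 'p \<Rightarrow> bool" where
  "smax A S k \<longleftrightarrow> k \<in> S \<and> (\<forall>x\<in>S. x \<noteq> k \<longrightarrow> A x < A k)"

text \<open>\<open>I\<close> is a set of rows, which lets one notion serve single rows and the whole
  array. The value types differ so that integer arrays can be compared with arrays over another
  order.\<close>

definition agree ::
  "'i set \<Rightarrow> ('i \<times> nat \<Rightarrow> 'b::linorder) \<Rightarrow> ('i \<times> nat \<Rightarrow> 'c::linorder) \<Rightarrow> nat \<Rightarrow> nat \<Rightarrow> bool" where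
  "agree I A B l r \<longleftrightarrow>
     (\<forall>i j p. l \<le> i \<longrightarrow> j \<le> r \<longrightarrow> smax A (I \<times> {i..<j}) p = smax B (I \<times> {i..<j}) p)"

text \<open>A node stores only the row of a maximum. Its column is \<open>l\<close> plus the size of
  the left subtree, so shape and rows already fix all positions.\<close>

inductive cart :: "'i set \<Rightarrow> ('i \<times> nat \<Rightarrow> 'b::linorder) \<Rightarrow> nat \<Rightarrow> nat \<Rightarrow> 'i tree \<Rightarrow> bool"
  for I A where
  cart_Leaf: "cart I A l l Leaf"
| cart_Node: "\<lbrakk>smax A (I \<times> {l..<r}) (i, m); cart I A l m t; cart I A (Suc m) r u\<rbrakk>
    \<Longrightarrow> cart I A l r (Node t i u)"

lemma smax_unique: "smax A S p \<Longrightarrow> smax A S q \<Longrightarrow> p = q"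
  unfolding smax_def by (metis order_less_asym)

lemma smax_exists:
  assumes "finite S" "S \<noteq> {}" "inj_on A S"
  shows "\<exists>p. smax A S p"
proof -
  have "Max (A ` S) \<in> A ` S" using assms by auto
  then obtain p where p: "p \<in> S" "A p = Max (A ` S)" by auto
  have "A x < A p" if "x \<in> S" "x \<noteq> p" for x
    using that p assms by (metis Max_ge finite_imageI imageI inj_onD order_le_less)
  with p show ?thesis unfolding smax_def by auto
qed

lemma smax_subset: "smax A S p \<Longrightarrow> T \<subseteq> S \<Longrightarrow> p \<in> T \<Longrightarrow> smax A T p"
  unfolding smax_def by blast

lemma agree_sym: "agree I A B l r \<Longrightarrow> agree I B A l r"
  by (simp add: agree_def)

lemma agree_trans: "agree I A B l r \<Longrightarrow> agree I B C l r \<Longrightarrow> agree I A C l r"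
  by (simp add: agree_def)

lemma agree_sub: "agree I A B l r \<Longrightarrow> l \<le> l' \<Longrightarrow> r' \<le> r \<Longrightarrow> agree I A B l' r'"
  by (simp add: agree_def)

lemma agree_smax:
  "agree I A B l r \<Longrightarrow> smax A (I \<times> {l..<r}) p \<Longrightarrow> smax B (I \<times> {l..<r}) p"
  unfolding agree_def by blast

lemma agree_mono:
  assumes "\<And>p q. p \<in> I \<times> {l..<r} \<Longrightarrow> q \<in> I \<times> {l..<r} \<Longrightarrow> A p < A q \<longleftrightarrow> B p < B q"
  shows "agree I A B l r"
  unfolding agree_def
proof (intro allI impI)
  fix i j p assume "l \<le> i" "j \<le> r"
  then have "I \<times> {i..<j} \<subseteq> I \<times> {l..<r}" by auto
  then show "smax A (I \<times> {i..<j}) p = smax B (I \<times> {i..<j}) p"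
    unfolding smax_def using assms by (meson subsetD)
qed

text \<open>An interval that avoids column \<open>m\<close> lies in one of the two parts. An
  interval across \<open>m\<close> contains \<open>(i, m)\<close>, and a maximum of the whole strip
  stays the maximum of every subset containing it.\<close>

lemma agree_join:
  assumes "smax A (I \<times> {l..<r}) (i, m)" "smax B (I \<times> {l..<r}) (i, m)"
    and "agree I A B l m" "agree I A B (Suc m) r"
  shows "agree I A B l r"
  unfolding agree_def
proof (intro allI impI)
  fix i' j p assume ij: "l \<le> i'" "j \<le> r"
  consider "j \<le> m" | "m < i'" | "i' \<le> m" "m < j" by linarith
  then show "smax A (I \<times> {i'..<j}) p = smax B (I \<times> {i'..<j}) p"
  proof cases
    case 3
    have "I \<times> {i'..<j} \<subseteq> I \<times> {l..<r}" "(i, m) \<in> I \<times> {i'..<j}"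
      using 3 ij assms(1) by (auto simp: smax_def)
    then have "smax A (I \<times> {i'..<j}) (i, m)" "smax B (I \<times> {i'..<j}) (i, m)"
      using smax_subset[OF assms(1)] smax_subset[OF assms(2)] by simp_all
    then show ?thesis by (metis smax_unique)
  next
    case 1
    then show ?thesis using assms(3) ij unfolding agree_def by blast
  next
    case 2
    then show ?thesis using assms(4) ij unfolding agree_def by (meson Suc_leI)
  qed
qed

lemma smax_strip_bounds: "smax A (I \<times> {l..<r}) (i, m) \<Longrightarrow> i \<in> I \<and> l \<le> m \<and> m < r"
  by (auto simp: smax_def)

lemma cart_size: "cart I A l r t \<Longrightarrow> size t = r - l \<and> l \<le> r \<and> set_tree t \<subseteq> I"
  by (induction rule: cart.induct) (auto dest: smax_strip_bounds)

lemma cart_exists: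
  assumes "finite I" "I \<noteq> {}" "inj_on A (I \<times> {l..<r})" "l \<le> r"
  shows "\<exists>t. cart I A l r t"
  using assms(3,4)
proof (induction "r - l" arbitrary: l r rule: less_induct)
  case less
  show ?case
  proof (cases "l = r")
    case True
    then show ?thesis using cart_Leaf by blast
  next
    case False
    then obtain i m where im: "smax A (I \<times> {l..<r}) (i, m)"
      using smax_exists[of "I \<times> {l..<r}" A] assms(1,2) less.prems by fastforce
    have b: "l \<le> m" "m < r" using smax_strip_bounds[OF im] by auto
    have "\<exists>t. cart I A l m t"
      using b by (intro less.hyps) (auto intro: inj_on_subset[OF less.prems(1)])
    moreover have "\<exists>t. cart I A (Suc m) r t"
      using b by (intro less.hyps) (auto intro: inj_on_subset[OF less.prems(1)])
    ultimately show ?thesis using cart_Node[OF im] by blast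
  qed
qed

lemma cart_agree: "cart I A l r t \<Longrightarrow> agree I A B l r \<Longrightarrow> cart I B l r t"
proof (induction rule: cart.induct)
  case (cart_Node l r i m t u)
  have b: "l \<le> m" "m < r" using smax_strip_bounds[OF cart_Node.hyps(1)] by auto
  have "agree I A B l m" "agree I A B (Suc m) r"
    using b by (auto intro: agree_sub[OF cart_Node.prems])
  then show ?case
    by (intro cart.cart_Node[OF agree_smax[OF cart_Node.prems cart_Node.hyps(1)]] cart_Node.IH)
qed (rule cart.cart_Leaf)

lemma cart_unique: "cart I A l r t \<Longrightarrow> cart I A l r t' \<Longrightarrow> t = t'"
proof (induction arbitrary: t' rule: cart.induct)
  case (cart_Leaf l)
  then show ?case using cart_size by fastforce
next
  case (cart_Node l r i m t u)
  from cart_Node.prems show ?case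
  proof cases
    case cart_Leaf
    then show ?thesis using cart_Node.hyps(1) by (simp add: smax_def)
  next
    case (cart_Node i' m' t2 u2)
    then show ?thesis using cart_Node.IH smax_unique[OF cart_Node.hyps(1)] by blast
  qed
qed

text \<open>Row maxima locate the column of a joint maximum once its row is known, so the
  row structures together with the row labels in preorder determine the joint tree.\<close>

lemma cart_preorder_agree:
  assumes "cart I A l r t" "cart I B l r u" "preorder t = preorder u"
    and "\<And>i. i \<in> I \<Longrightarrow> agree {i} A B l r"
  shows "agree I A B l r"
  using assms
proof (induction arbitrary: u rule: cart.induct)
  case (cart_Leaf l)
  then show ?case by (auto simp: agree_def smax_def)
next
  case (cart_Node l r i m t1 t2)
  from cart_Node.prems(1) show ?case
  proof cases
    case cart_Leaf
    then show ?thesis using cart_Node.hyps(1) by (simp add: smax_def)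
  next
    case (cart_Node i' m' u1 u2)
    have i: "i' = i" using cart_Node(1) cart_Node.prems(2) by simp
    note b = smax_strip_bounds[OF cart_Node.hyps(1)] smax_strip_bounds[OF cart_Node(2)]
    have "smax A ({i} \<times> {l..<r}) (i, m)" "smax B ({i} \<times> {l..<r}) (i, m')"
      using cart_Node.hyps(1) cart_Node(2) i b by (auto intro: smax_subset)
    then have m: "m' = m"
      using cart_Node.prems(3) agree_smax smax_unique b by (metis prod.inject)
    \<comment> \<open>Both left subtrees cover the columns from \<open>l\<close> up to
      \<open>m\<close>; their equal size tells where to cut the concatenated label words.\<close>
    have "size t1 = size u1"
      using cart_size cart_Node.hyps(2) cart_Node(3) m by metis
    then have "preorder t1 = preorder u1" "preorder t2 = preorder u2"
      using cart_Node.prems(2) cart_Node(1) by simp_all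
    moreover have "agree {i} A B l m" "agree {i} A B (Suc m) r" if "i \<in> I" for i
      using b by (auto intro: agree_sub[OF cart_Node.prems(3)[OF that]])
    ultimately have "agree I A B l m" "agree I A B (Suc m) r"
      using cart_Node.IH cart_Node(3,4) unfolding m by blast+
    then show ?thesis by (rule agree_join[OF cart_Node.hyps(1) cart_Node(2)[unfolded i m]])
  qed
qed

text \<open>Together with \<open>cart_agree\<close> this makes the tree a complete invariant of the
  range maxima. The root columns coincide because the left subtree has one node for each column
  before the root.\<close>

lemma cart_imp_agree:
  assumes "cart I A l r t" "cart I B l r t"
  shows "agree I A B l r"
  using assms
proof (induction rule: cart.induct)
  case (cart_Leaf l)
  then show ?case by (auto simp: agree_def smax_def)
next
  case (cart_Node l r i m t u)
  from cart_Node.prems obtain m' where m': "smax B (I \<times> {l..<r}) (i, m')"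
    "cart I B l m' t" "cart I B (Suc m') r u" by cases auto
  have "m' = m"
    using m' cart_size[OF cart_Node.hyps(2)] cart_size[OF m'(2)] by linarith
  with m' have "agree I A B l m" "agree I A B (Suc m) r" using cart_Node.IH by auto
  then show ?case by (rule agree_join[OF cart_Node.hyps(1) m'(1)[unfolded \<open>m' = m\<close>]])
qed

section \<open>Arrays with prescribed trees\<close>

text \<open>Column \<open>m\<close> is a block of its own: next to the joint maximum it may hold a
  cell of the other row, whose value must be placed independently of both sides.\<close>

definition block :: "nat \<Rightarrow> nat \<Rightarrow> nat" where
  "block m j = (if j < m then 0 else if j = m then 1 else 2)"

text \<open>A strictly increasing rescaling for each block; the residues keep the values of
  different blocks distinct.\<close>

definition scaling :: "(nat \<Rightarrow> int \<Rightarrow> int) \<Rightarrow> bool" where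
  "scaling \<phi> \<longleftrightarrow> (\<forall>b. strict_mono (\<phi> b)) \<and> (\<forall>b v. \<phi> b v mod 3 = int b mod 3)"

definition rescale :: "(nat \<Rightarrow> int \<Rightarrow> int) \<Rightarrow> nat \<Rightarrow> ('i \<times> nat \<Rightarrow> int) \<Rightarrow> 'i \<times> nat \<Rightarrow> int" where
  "rescale \<phi> m D p = \<phi> (block m (snd p)) (D p)"

lemma finite_int_bounded: "finite S \<Longrightarrow> \<exists>K::int. \<forall>p\<in>S. f p < K"
  by (rule exI[of _ "Max (f ` S) + 1"]) (simp add: le_imp_less_Suc zle_add1_eq_le)

lemma scaling_exists: "\<exists>\<phi>. scaling \<phi>"
  by (rule exI[of _ "\<lambda>b v. 3 * v + int b"]) (simp add: scaling_def strict_mono_def)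

lemma scaling_less_iff: "scaling \<phi> \<Longrightarrow> \<phi> b v < \<phi> b w \<longleftrightarrow> v < w"
  by (simp add: scaling_def strict_mono_less)

lemma scaling_eqD: "scaling \<phi> \<Longrightarrow> \<phi> (block m i) v = \<phi> (block m j) w \<Longrightarrow> block m i = block m j \<and> v = w"
proof -
  assume s: "scaling \<phi>" and e: "\<phi> (block m i) v = \<phi> (block m j) w"
  have "int (block m i) mod 3 = int (block m j) mod 3"
    using s e unfolding scaling_def by metis
  then have "block m i = block m j" by (auto simp: block_def split: if_splits)
  then show ?thesis using s e unfolding scaling_def by (metis strict_mono_eq)
qed

lemma agree_rescale:
  assumes "scaling \<phi>" "r \<le> m \<or> m < l"
  shows "agree I (rescale \<phi> m D) D l r"
proof (rule agree_mono)
  fix p q assume "p \<in> I \<times> {l..<r}" "q \<in> I \<times> {l..<r}"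
  then have "block m (snd p) = block m (snd q)"
    using assms(2) by (auto simp: block_def)
  then show "rescale \<phi> m D p < rescale \<phi> m D q \<longleftrightarrow> D p < D q"
    by (simp add: rescale_def scaling_less_iff[OF assms(1)])
qed

text \<open>Two blocks separated by column \<open>m\<close> can be interleaved so that row \<open>k\<close> gets any
  prescribed structure that is compatible with both of them: if the maximum \<open>p\<close> of the
  prescribed row lies in some block, it suffices to lift the values of that block from
  \<open>D (k, p)\<close> upwards.\<close>

lemma scaling_merge:
  fixes C :: "'i \<times> nat \<Rightarrow> 'c::linorder" and D :: "'i \<times> nat \<Rightarrow> int"
  assumes "inj_on C ({k} \<times> {l..<r})"
    and "\<And>i j. l \<le> i \<Longrightarrow> j \<le> r \<Longrightarrow> j \<le> m \<or> m < i \<Longrightarrow> agree {k} D C i j"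
  shows "\<exists>\<phi>. scaling \<phi> \<and> agree {k} (rescale \<phi> m D) C l r"
  using assms
proof (induction "r - l" arbitrary: l r rule: less_induct)
  case less
  \<comment> \<open>Intervals that avoid column \<open>m\<close> come out right under every scaling,
    so only intervals across \<open>m\<close> constrain the choice.\<close>
  have side: "agree {k} (rescale \<phi> m D) C l' r'"
    if "scaling \<phi>" "l \<le> l'" "r' \<le> r" "r' \<le> m \<or> m < l'" for \<phi> l' r'
    using agree_trans[OF agree_rescale less.prems(2)] that by blast
  show ?case
  proof (cases "l \<le> m \<and> m < r")
    case False
    then show ?thesis using scaling_exists side by (meson le_refl not_le)
  next
    case True
    then have "\<exists>x. smax C ({k} \<times> {l..<r}) x"
      using less.prems(1) by (intro smax_exists) auto
    then obtain p where p: "smax C ({k} \<times> {l..<r}) (k, p)"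
      by (auto simp: smax_def)
    then have b: "l \<le> p" "p < r" by (auto simp: smax_def)
    have ih: "\<exists>\<phi>. scaling \<phi> \<and> agree {k} (rescale \<phi> m D) C l' r'"
      if "l \<le> l'" "r' \<le> r" "r' - l' < r - l" for l' r'
    proof (rule less.hyps[OF that(3)])
      show "inj_on C ({k} \<times> {l'..<r'})"
        using that by (intro inj_on_subset[OF less.prems(1)]) auto
      show "agree {k} D C i j" if "l' \<le> i" "j \<le> r'" "j \<le> m \<or> m < i" for i j
        using that \<open>l \<le> l'\<close> \<open>r' \<le> r\<close> by (intro less.prems(2)) auto
    qed
    \<comment> \<open>One of the two parts next to column \<open>p\<close> avoids column
      \<open>m\<close>, so any scaling suits it; the scaling is therefore chosen by induction for
      the other part alone.\<close>
    have "\<exists>\<phi>. scaling \<phi> \<and> agree {k} (rescale \<phi> m D) C l p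
        \<and> agree {k} (rescale \<phi> m D) C (Suc p) r"
    proof (cases "p \<le> m")
      case True
      have "\<exists>\<phi>. scaling \<phi> \<and> agree {k} (rescale \<phi> m D) C (Suc p) r"
        using b by (intro ih) auto
      then obtain \<phi> where "scaling \<phi>" "agree {k} (rescale \<phi> m D) C (Suc p) r"
        by blast
      then show ?thesis using side[of \<phi> l p] True b by auto
    next
      case False
      have "\<exists>\<phi>. scaling \<phi> \<and> agree {k} (rescale \<phi> m D) C l p"
        using b by (intro ih) auto
      then obtain \<phi> where "scaling \<phi>" "agree {k} (rescale \<phi> m D) C l p"
        by blast
      then show ?thesis using side[of \<phi> "Suc p" r] False b by auto
    qed
    then obtain \<phi> where \<phi>: "scaling \<phi>" "agree {k} (rescale \<phi> m D) C l p"
      "agree {k} (rescale \<phi> m D) C (Suc p) r" by blast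
    define E where "E = rescale \<phi> m D"
    obtain K0 where K0: "\<forall>q\<in>{k} \<times> {l..<r}. E q < K0"
      using finite_int_bounded[of "{k} \<times> {l..<r}" E] by auto
    \<comment> \<open>Truncation at 0 makes the lift nonnegative, which keeps the lifted scaling
      increasing. The lift is by \<open>3 * K\<close> so that residues modulo 3 survive.\<close>
    define K where "K = max 0 (K0 - E (k, p))"
    have "0 \<le> K" "K0 \<le> E (k, p) + K" by (simp_all add: K_def)
    then have K: "E q < E (k, p) + 3 * K" if "q \<in> {k} \<times> {l..<r}" for q
      using bspec[OF K0 that] by linarith
    define c where "c = block m p"
    define \<psi> where "\<psi> = \<phi>(c := \<lambda>v. if v < D (k, p) then \<phi> c v else \<phi> c v + 3 * K)"
    have mono: "strict_mono (\<phi> b)" and res: "\<phi> b v mod 3 = int b mod 3" for b v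
      using \<phi>(1) by (auto simp: scaling_def)
    have \<psi>: "scaling \<psi>"
      unfolding scaling_def
    proof (intro conjI allI)
      show "strict_mono (\<psi> b)" for b
      proof (rule strict_monoI)
        fix v w :: int assume "v < w"
        with mono[of b] have "\<phi> b v < \<phi> b w" by (rule strict_monoD)
        with \<open>v < w\<close> \<open>0 \<le> K\<close> show "\<psi> b v < \<psi> b w" by (auto simp: \<psi>_def)
      qed
      show "\<psi> b v mod 3 = int b mod 3" for b v
        using res[of b v] by (auto simp: \<psi>_def)
    qed
    \<comment> \<open>In row \<open>k\<close> the lift moves only the value at column
      \<open>p\<close>: by compatibility with \<open>C\<close>, all other cells of its block have
      values of \<open>D\<close> below \<open>D (k, p)\<close>.\<close>
    have eq: "rescale \<psi> m D q = E q" if q: "q \<in> {k} \<times> {l..<r}" "q \<noteq> (k, p)" for q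
    proof (cases "block m (snd q) = c")
      case False
      then show ?thesis by (simp add: rescale_def E_def \<psi>_def)
    next
      case True
      obtain j where j: "q = (k, j)" "l \<le> j" "j < r" using q(1) by auto
      then have "j \<noteq> p" using q(2) by simp
      then consider "j < m" "p < m" | "m < j" "m < p"
        using True j(1) by (auto simp: c_def block_def split: if_splits)
      then have "\<exists>l' r'. l \<le> l' \<and> r' \<le> r \<and> (r' \<le> m \<or> m < l') \<and> p \<in> {l'..<r'} \<and> j \<in> {l'..<r'}"
      proof cases
        case 1
        then show ?thesis
          using j b \<open>l \<le> m \<and> m < r\<close> by (intro exI[of _ l] exI[of _ m]) auto
      next
        case 2
        then show ?thesis
          using j b \<open>l \<le> m \<and> m < r\<close> by (intro exI[of _ "Suc m"] exI[of _ r]) auto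
      qed
      then obtain l' r' where lr: "l \<le> l'" "r' \<le> r" "r' \<le> m \<or> m < l'"
        "p \<in> {l'..<r'}" "j \<in> {l'..<r'}" by blast
      have "smax C ({k} \<times> {l'..<r'}) (k, p)"
        using lr by (intro smax_subset[OF p]) auto
      then have "smax D ({k} \<times> {l'..<r'}) (k, p)"
        using agree_smax[OF agree_sym[OF less.prems(2)[OF lr(1-3)]]] by simp
      then have "D q < D (k, p)" using lr j \<open>j \<noteq> p\<close> by (auto simp: smax_def)
      then show ?thesis using True by (simp add: rescale_def E_def \<psi>_def)
    qed
    have "rescale \<psi> m D (k, p) = E (k, p) + 3 * K"
      by (simp add: rescale_def E_def \<psi>_def c_def)
    then have top: "smax (rescale \<psi> m D) ({k} \<times> {l..<r}) (k, p)"
      using eq K b unfolding smax_def by auto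
    have "agree {k} (rescale \<psi> m D) E l p" "agree {k} (rescale \<psi> m D) E (Suc p) r"
      using eq b by (auto intro!: agree_mono)
    then have "agree {k} (rescale \<psi> m D) C l p" "agree {k} (rescale \<psi> m D) C (Suc p) r"
      using \<phi>(2,3) agree_trans unfolding E_def by blast+
    then show ?thesis using agree_join[OF top p] \<psi> by blast
  qed
qed

text \<open>Choosing \<open>K\<close> above all rescaled values puts the maximum at
  \<open>(i, m)\<close>. Equal values elsewhere lie in the same block, hence in one injective part,
  or in column \<open>m\<close>, where at most one other cell exists as there are at most two rows.
  The equation for \<open>Z\<close> is exported so that order arranged by the scaling can be
  reused.\<close>

lemma splice:
  fixes A B :: "'i \<times> nat \<Rightarrow> int"
  assumes \<phi>: "scaling \<phi>" and "l \<le> m" "m < r" "i \<in> I" "I \<subseteq> {i, k}"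
    and "inj_on A (I \<times> {l..<m})" "inj_on B (I \<times> {Suc m..<r})"
    and D: "\<And>p. D p = (if snd p < m then A p else B p)"
  shows "\<exists>Z K. Z = (rescale \<phi> m D)((i, m) := K) \<and>
     inj_on Z (I \<times> {l..<r}) \<and> smax Z (I \<times> {l..<r}) (i, m) \<and>
     (\<forall>J. agree J Z A l m \<and> agree J Z B (Suc m) r)"
proof -
  have "finite I" using assms(5) finite_subset by blast
  then obtain K where K: "\<forall>p\<in>I \<times> {l..<r}. rescale \<phi> m D p < K"
    using finite_int_bounded[of "I \<times> {l..<r}" "rescale \<phi> m D"] by auto
  define Z where "Z = (rescale \<phi> m D)((i, m) := K)"
  have "inj_on Z (I \<times> {l..<r} - {(i, m)})"
  proof (rule inj_onI)
    fix p q assume pq: "p \<in> I \<times> {l..<r} - {(i, m)}" "q \<in> I \<times> {l..<r} - {(i, m)}" "Z p = Z q"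
    then have "rescale \<phi> m D p = rescale \<phi> m D q" by (auto simp: Z_def)
    then have *: "block m (snd p) = block m (snd q)" "D p = D q"
      using scaling_eqD[OF \<phi>] unfolding rescale_def by blast+
    consider "snd p < m" "snd q < m" | "snd p = m" "snd q = m" | "m < snd p" "m < snd q"
      using *(1) by (auto simp: block_def split: if_splits)
    then show "p = q"
    proof cases
      case 1
      then have "A p = A q" using *(2) D by simp
      then show ?thesis using 1 pq by (intro inj_onD[OF assms(6)]) auto
    next
      case 2
      then show ?thesis using pq assms(5) by (cases p; cases q) auto
    next
      case 3
      then have "B p = B q" using *(2) D by simp
      then show ?thesis using 3 pq by (intro inj_onD[OF assms(7)]) auto
    qed
  qed
  moreover have top: "smax Z (I \<times> {l..<r}) (i, m)"
    using K assms(2-4) by (auto simp: smax_def Z_def)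
  moreover have "Z (i, m) \<notin> Z ` (I \<times> {l..<r} - {(i, m)})"
  proof
    assume "Z (i, m) \<in> Z ` (I \<times> {l..<r} - {(i, m)})"
    then obtain p where "p \<in> I \<times> {l..<r} - {(i, m)}" "Z p = Z (i, m)" by fastforce
    moreover from this have "Z p < Z (i, m)" using top unfolding smax_def by blast
    ultimately show False by simp
  qed
  ultimately have "inj_on Z (insert (i, m) (I \<times> {l..<r} - {(i, m)}))"
    unfolding inj_on_insert by simp
  moreover have "insert (i, m) (I \<times> {l..<r} - {(i, m)}) = I \<times> {l..<r}"
    using assms(2-4) by auto
  moreover have "agree J Z A l m" for J
    by (rule agree_mono) (auto simp: Z_def rescale_def block_def D scaling_less_iff[OF \<phi>])
  moreover have "agree J Z B (Suc m) r" for J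
    by (rule agree_mono) (auto simp: Z_def rescale_def block_def D scaling_less_iff[OF \<phi>])
  ultimately show ?thesis using top Z_def by metis
qed

text \<open>With a single row there is nothing to interleave, so \<open>splice\<close> works with an
  arbitrary scaling.\<close>

lemma cart_row_realizable:
  assumes "set_tree t \<subseteq> {i}"
  shows "\<exists>C :: 'i \<times> nat \<Rightarrow> int.
    inj_on C ({i} \<times> {l..<l + size t}) \<and> cart {i} C l (l + size t) t"
  using assms
proof (induction t arbitrary: l)
  case Leaf
  then show ?case by (auto intro: cart_Leaf)
next
  case (Node t x u)
  define m where "m = l + size t"
  define r where "r = l + size (Node t x u)"
  have r: "r = Suc m + size u" by (simp add: r_def m_def)
  obtain A :: "'i \<times> nat \<Rightarrow> int" where A: "inj_on A ({i} \<times> {l..<m})" "cart {i} A l m t"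
    using Node.IH(1)[of l] Node.prems unfolding m_def by auto
  obtain B :: "'i \<times> nat \<Rightarrow> int" where
    B: "inj_on B ({i} \<times> {Suc m..<r})" "cart {i} B (Suc m) r u"
    using Node.IH(2)[of "Suc m"] Node.prems unfolding r by auto
  obtain \<phi> where \<phi>: "scaling \<phi>" using scaling_exists by auto
  have b: "l \<le> m" "m < r" by (simp_all add: m_def r_def)
  obtain Z :: "'i \<times> nat \<Rightarrow> int" where Z: "inj_on Z ({i} \<times> {l..<r})" "smax Z ({i} \<times> {l..<r}) (i, m)"
    "agree {i} Z A l m" "agree {i} Z B (Suc m) r"
    using splice[OF \<phi> b insertI1 subset_insertI A(1) B(1) refl] by blast
  have "x = i" using Node.prems by simp
  then have "cart {i} Z l r (Node t x u)"
    using cart_Node[OF Z(2)] cart_agree[OF A(2) agree_sym[OF Z(3)]]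
      cart_agree[OF B(2) agree_sym[OF Z(4)]] by simp
  with Z(1) show ?case unfolding r_def by blast
qed

text \<open>The first label names the row of the joint maximum, the structure of that row in
  \<open>C\<close> gives its column, and the remaining labels are split there. Only comparisons
  within one row of \<open>C\<close> enter.\<close>

lemma cart_realizable:
  fixes C :: "'i \<times> nat \<Rightarrow> 'c::linorder"
  assumes "i \<noteq> k" "l \<le> r" "length bs = r - l" "set bs \<subseteq> {i, k}"
    and "\<And>x. x \<in> {i, k} \<Longrightarrow> inj_on C ({x} \<times> {l..<r})"
  shows "\<exists>(A :: 'i \<times> nat \<Rightarrow> int) t. inj_on A ({i, k} \<times> {l..<r}) \<and>
    (\<forall>x\<in>{i, k}. agree {x} A C l r) \<and> cart {i, k} A l r t \<and> preorder t = bs"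
  using assms
proof (induction "length bs" arbitrary: bs l r i k rule: less_induct)
  case less
  show ?case
  proof (cases bs)
    case Nil
    then have "l = r" using less.prems by simp
    then show ?thesis using Nil
      by (intro exI[of _ "\<lambda>_. 0"] exI[of _ Leaf]) (auto intro: cart_Leaf simp: agree_def smax_def)
  next
    case (Cons x cs)
    obtain y where y: "{i, k} = {x, y}" "x \<noteq> y" using Cons less.prems(1,4) by auto
    have "l < r" using Cons less.prems by simp
    then have "\<exists>p. smax C ({x} \<times> {l..<r}) p"
      using less.prems(5)[of x] y by (intro smax_exists) auto
    then obtain m where m: "smax C ({x} \<times> {l..<r}) (x, m)" by (auto simp: smax_def)
    then have b: "l \<le> m" "m < r" by (auto simp: smax_def)
    define us where "us = take (m - l) cs"
    define vs where "vs = drop (m - l) cs"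
    have cs: "cs = us @ vs" by (simp add: us_def vs_def)
    have len: "length us = m - l" "length vs = r - Suc m"
      using less.prems(3) Cons b by (auto simp: us_def vs_def)
    have inj: "inj_on C ({z} \<times> {l'..<r'})" if "z \<in> {x, y}" "l \<le> l'" "r' \<le> r" for z l' r'
      using that y by (intro inj_on_subset[OF less.prems(5)]) auto
    have "\<exists>(A :: 'i \<times> nat \<Rightarrow> int) t. inj_on A ({x, y} \<times> {l..<m}) \<and>
        (\<forall>z\<in>{x, y}. agree {z} A C l m) \<and> cart {x, y} A l m t \<and> preorder t = us"
      using less.prems(4) y b len Cons cs inj by (intro less.hyps) auto
    then obtain A :: "'i \<times> nat \<Rightarrow> int" and t where A: "inj_on A ({x, y} \<times> {l..<m})"
      "\<forall>z\<in>{x, y}. agree {z} A C l m" "cart {x, y} A l m t" "preorder t = us" by blast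
    have "\<exists>(B :: 'i \<times> nat \<Rightarrow> int) u. inj_on B ({x, y} \<times> {Suc m..<r}) \<and>
        (\<forall>z\<in>{x, y}. agree {z} B C (Suc m) r) \<and> cart {x, y} B (Suc m) r u \<and> preorder u = vs"
      using less.prems(4) y b len Cons cs inj by (intro less.hyps) auto
    then obtain B :: "'i \<times> nat \<Rightarrow> int" and u where B: "inj_on B ({x, y} \<times> {Suc m..<r})"
      "\<forall>z\<in>{x, y}. agree {z} B C (Suc m) r" "cart {x, y} B (Suc m) r u" "preorder u = vs" by blast
    \<comment> \<open>In column \<open>m\<close> the value of \<open>D\<close> is arbitrary:
      \<open>scaling_merge\<close> moves the cell \<open>(y, m)\<close> to its place, and
      \<open>splice\<close> overwrites \<open>(x, m)\<close>.\<close>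
    define D where "D p = (if snd p < m then A p else B p)" for p
    have "agree {y} D C i' j'" if "l \<le> i'" "j' \<le> r" "j' \<le> m \<or> m < i'" for i' j'
    proof (cases "j' \<le> m")
      case True
      have "agree {y} D A i' j'" using True by (intro agree_mono) (auto simp: D_def)
      moreover have "agree {y} A C i' j'" using A(2) True that by (auto intro: agree_sub)
      ultimately show ?thesis by (rule agree_trans)
    next
      case False
      have "agree {y} D B i' j'" using False that by (intro agree_mono) (auto simp: D_def)
      moreover have "agree {y} B C i' j'" using B(2) False that by (auto intro: agree_sub)
      ultimately show ?thesis by (rule agree_trans)
    qed
    then obtain \<phi> where \<phi>: "scaling \<phi>" "agree {y} (rescale \<phi> m D) C l r"
      using scaling_merge[of C y l r m D] inj[of y l r] by auto
    obtain K Z where Z: "Z = (rescale \<phi> m D)((x, m) := K)"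
      "inj_on Z ({x, y} \<times> {l..<r})" "smax Z ({x, y} \<times> {l..<r}) (x, m)"
      "\<And>J. agree J Z A l m" "\<And>J. agree J Z B (Suc m) r"
      using splice[OF \<phi>(1) b _ _ A(1) B(1) D_def, of x y] by blast
    \<comment> \<open>The inserted maximum lies in row \<open>x\<close>, so it leaves the order
      arranged in row \<open>y\<close> intact.\<close>
    have "agree {y} Z (rescale \<phi> m D) l r"
      using y(2) by (intro agree_mono) (auto simp: Z(1))
    then have "agree {y} Z C l r" using \<phi>(2) agree_trans by blast
    \<comment> \<open>Row \<open>x\<close> imposes nothing on the scaling: its maximum is the
      inserted cell, and both sides agree with \<open>C\<close> by induction.\<close>
    moreover have "agree {x} Z C l r"
    proof (rule agree_join[OF _ m])
      show "smax Z ({x} \<times> {l..<r}) (x, m)" using b by (intro smax_subset[OF Z(3)]) auto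
      show "agree {x} Z C l m" using agree_trans[OF Z(4)] A(2) by blast
      show "agree {x} Z C (Suc m) r" using agree_trans[OF Z(5)] B(2) by blast
    qed
    moreover have "cart {x, y} Z l r (Node t x u)"
      by (intro cart_Node[OF Z(3)] cart_agree[OF A(3) agree_sym[OF Z(4)]]
          cart_agree[OF B(3) agree_sym[OF Z(5)]])
    moreover have "preorder (Node t x u) = bs" using A(4) B(4) Cons cs by simp
    ultimately show ?thesis using Z(2) unfolding y(1) by blast
  qed
qed

section \<open>Counting\<close>

text \<open>Forests rather than single trees give a linear recursion, since removing the root of the
  first tree replaces it by two trees. The label is fixed so that only shapes are counted.\<close>

definition forests :: "'i \<Rightarrow> nat \<Rightarrow> nat \<Rightarrow> 'i tree list set" where
  "forests i k n = {ts. length ts = k \<and> sum_list (map size ts) = n \<and> (\<forall>t\<in>set ts. set_tree t \<subseteq> {i})}"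

definition trees :: "'i \<Rightarrow> nat \<Rightarrow> 'i tree set" where
  "trees i n = {t. size t = n \<and> set_tree t \<subseteq> {i}}"

lemma forests_0: "forests i 0 n = (if n = 0 then {[]} else {})"
  by (auto simp: forests_def)

lemma forests_Suc_0: "forests i (Suc k) 0 = Cons Leaf ` forests i k 0"
proof
  show "forests i (Suc k) 0 \<subseteq> Cons Leaf ` forests i k 0"
  proof
    fix ts assume ts: "ts \<in> forests i (Suc k) 0"
    then obtain t us where "ts = t # us" by (cases ts) (auto simp: forests_def)
    with ts show "ts \<in> Cons Leaf ` forests i k 0" by (simp add: forests_def)
  qed
qed (auto simp: forests_def)

lemma forests_Suc_SucE:
  assumes "ts \<in> forests i (Suc (Suc k)) n"
  obtains l r us where "ts = l # r # us"
  using assms unfolding forests_def mem_Collect_eq by (metis Suc_length_conv)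

lemma forests_Suc_Suc:
  "forests i (Suc k) (Suc n) = Cons Leaf ` forests i k (Suc n) \<union>
     (\<lambda>ts. Node (hd ts) i (hd (tl ts)) # tl (tl ts)) ` forests i (Suc (Suc k)) n" (is "?L = ?R")
proof
  show "?L \<subseteq> ?R"
  proof
    fix ts assume ts: "ts \<in> ?L"
    then obtain t us where tu: "ts = t # us" by (cases ts) (auto simp: forests_def)
    show "ts \<in> ?R"
    proof (cases t)
      case Leaf
      then show ?thesis using ts tu by (auto simp: forests_def)
    next
      case (Node l x r)
      then have "x = i" "l # r # us \<in> forests i (Suc (Suc k)) n" using ts tu by (auto simp: forests_def)
      then show ?thesis using Node tu
        by (intro UnI2 image_eqI[of _ _ "l # r # us"]) auto
    qed
  qed
  show "?R \<subseteq> ?L"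
  proof (intro Un_least image_subsetI)
    show "Leaf # us \<in> ?L" if "us \<in> forests i k (Suc n)" for us
      using that by (simp add: forests_def)
    show "Node (hd ts) i (hd (tl ts)) # tl (tl ts) \<in> ?L"
      if ts: "ts \<in> forests i (Suc (Suc k)) n" for ts
      using ts by (rule forests_Suc_SucE) (use ts in \<open>simp add: forests_def\<close>)
  qed
qed

text \<open>Ballot numbers: the first tree of a forest is either a leaf, to be dropped, or a node, to
  be replaced by its two subtrees, and the resulting recursion is Pascal's rule.\<close>

lemma card_forests:
  "finite (forests i k n) \<and>
   card (forests i k n) + (if n = 0 then 0 else (2 * n + k - 1) choose (n - 1))
     = (2 * n + k - 1) choose n"
\<comment> \<open>The recursion either drops a tree with \<open>n\<close> fixed or trades one node
  for one more tree, hence an outer induction on \<open>n\<close> for all \<open>k\<close> and an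
  inner one on \<open>k\<close>.\<close>
proof (induction n arbitrary: k)
  case 0
  show ?case
  proof (induction k)
    case (Suc k)
    then show ?case by (simp add: forests_Suc_0 card_image)
  qed (simp add: forests_0)
next
  case (Suc n)
  note outer = Suc.IH
  show ?case
  proof (induction k)
    case 0
    \<comment> \<open>Without trees there are no nodes, so the count must vanish: these are the two
      equal middle binomials of an odd row.\<close>
    have "Suc (2 * n) choose n = Suc (2 * n) choose Suc n"
      by (subst binomial_symmetric) simp_all
    then show ?case by (simp add: forests_0)
  next
    case (Suc k)
    let ?g = "\<lambda>ts. Node (hd ts) i (hd (tl ts)) # tl (tl ts)"
    have inj: "inj_on ?g (forests i (Suc (Suc k)) n)"
    proof (rule inj_onI)
      fix x y assume xy: "x \<in> forests i (Suc (Suc k)) n" "y \<in> forests i (Suc (Suc k)) n"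
        and eq: "?g x = ?g y"
      show "x = y"
        using xy(1)
      proof (rule forests_Suc_SucE)
        fix l r us assume "x = l # r # us"
        with eq show "x = y" by - (rule forests_Suc_SucE[OF xy(2)], simp)
      qed
    qed
    let ?M = "2 * n + k + 1"
    have 1: "finite (forests i k (Suc n))"
      "card (forests i k (Suc n)) + (?M choose n) = ?M choose Suc n"
      using Suc.IH by simp_all
    have e: "2 * n + Suc (Suc k) - 1 = ?M" by simp
    have 2: "finite (forests i (Suc (Suc k)) n)"
      "card (forests i (Suc (Suc k)) n) + (if n = 0 then 0 else ?M choose (n - 1)) = ?M choose n"
      using outer[of "Suc (Suc k)"] unfolding e by blast+
    have "card (forests i (Suc k) (Suc n))
        = card (Cons Leaf ` forests i k (Suc n)) + card (?g ` forests i (Suc (Suc k)) n)"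
      unfolding forests_Suc_Suc by (rule card_Un_disjoint) (use 1(1) 2(1) in auto)
    also have "\<dots> = card (forests i k (Suc n)) + card (forests i (Suc (Suc k)) n)"
      by (simp add: card_image[OF inj] card_image)
    finally have "card (forests i (Suc k) (Suc n))
        = card (forests i k (Suc n)) + card (forests i (Suc (Suc k)) n)" .
    moreover have "finite (forests i (Suc k) (Suc n))"
      unfolding forests_Suc_Suc using 1(1) 2(1) by blast
    moreover have "Suc ?M choose Suc n = (?M choose n) + (?M choose Suc n)"
      by simp
    \<comment> \<open>Pascal's rule for the subtracted binomial; the case distinction is due to
      \<open>n - 1\<close> being truncated at \<open>n = 0\<close>.\<close>
    moreover have "Suc ?M choose n = (?M choose n) + (if n = 0 then 0 else ?M choose (n - 1))"
      by (cases n) simp_all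
    ultimately have "card (forests i (Suc k) (Suc n)) + (Suc ?M choose n) = Suc ?M choose Suc n"
      using 1(2) 2(2) by linarith
    then show ?case using \<open>finite (forests i (Suc k) (Suc n))\<close> by simp
  qed
qed

text \<open>A tree is a forest of length one. The Catalan number appears as a difference of
  neighbouring binomials, written additively to avoid truncated subtraction.\<close>

lemma finite_trees: "finite (trees i n)"
  and card_trees: "n > 0 \<Longrightarrow> card (trees i n) + ((2 * n) choose (n - 1)) = (2 * n) choose n"
proof -
  have f: "forests i 1 n = (\<lambda>t. [t]) ` trees i n"
    by (auto simp: forests_def trees_def length_Suc_conv)
  then have "card (forests i 1 n) = card (trees i n)"
    by (simp add: card_image inj_on_def)
  then show "n > 0 \<Longrightarrow> card (trees i n) + ((2 * n) choose (n - 1)) = (2 * n) choose n"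
    using card_forests[of i 1 n] by auto
  show "finite (trees i n)"
    using card_forests[of i 1 n] f by (auto dest: finite_imageD simp: inj_on_def)
qed

lemma card_trees_le: "n > 0 \<Longrightarrow> card (trees i n) \<le> 4 ^ n"
proof -
  assume "n > 0"
  then have "card (trees i n) \<le> (2 * n) choose n"
    using card_trees[of n i] by linarith
  also have "\<dots> \<le> 2 ^ (2 * n)" by (rule binomial_le_pow2)
  finally show ?thesis by (simp add: power_mult)
qed

text \<open>Two absorption identities relate the neighbouring binomials by the factor
  \<open>n / (n + 1)\<close>, so their difference is the central binomial divided by
  \<open>n + 1\<close>. The central binomial is at least \<open>4 ^ n / (2 * n)\<close>.\<close>

lemma card_trees_ge:
  assumes "n > 0"
  shows "4 ^ n \<le> 2 * real n * (real n + 1) * real (card (trees i n))"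
proof -
  obtain k where k: "n = Suc k" using assms by (cases n) auto
  have "n * ((2 * n) choose n) = 2 * n * ((2 * n - 1) choose (n - 1))"
    using binomial_absorption[of k "2 * n"] by (simp add: k)
  also have "\<dots> = (n + 1) * ((2 * n) choose (n - 1))"
    using binomial_absorb_comp[of "2 * n" "n - 1"] by (simp add: k)
  finally have 1: "real n * real ((2 * n) choose n) = (real n + 1) * real ((2 * n) choose (n - 1))"
    by (metis of_nat_mult of_nat_Suc Suc_eq_plus1 add.commute)
  have 2: "real (card (trees i n)) = real ((2 * n) choose n) - real ((2 * n) choose (n - 1))"
    using card_trees[OF assms, of i] by linarith
  have "(real n + 1) * real (card (trees i n))
      = (real n + 1) * real ((2 * n) choose n) - real n * real ((2 * n) choose n)"
    unfolding 1 2 by (rule right_diff_distrib)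
  then have "(real n + 1) * real (card (trees i n)) = real ((2 * n) choose n)"
    by (simp add: distrib_right)
  moreover have "4 ^ n \<le> 2 * real n * real ((2 * n) choose n)"
    using central_binomial_lower_bound[OF assms] assms by (simp add: field_simps)
  ultimately show ?thesis by (simp add: mult.assoc)
qed

section \<open>Answer codes and their number\<close>

definition codes :: "nat \<Rightarrow> (nat tree \<times> nat tree \<times> nat list) set" where
  "codes n = trees 1 n \<times> trees 2 n \<times> {bs. set bs \<subseteq> {1, 2} \<and> length bs = n}"

text \<open>The joint tree is quantified away and only its label word is kept: its shape follows
  from the row trees and that word.\<close>

definition has_code ::
  "nat \<Rightarrow> (nat \<times> nat \<Rightarrow> 'b::linorder) \<Rightarrow> nat tree \<times> nat tree \<times> nat list \<Rightarrow> bool" where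
  "has_code n A c \<longleftrightarrow> (case c of (t, u, bs) \<Rightarrow>
     cart {1} A 1 (Suc n) t \<and> cart {2} A 1 (Suc n) u \<and>
     (\<exists>w. cart {1, 2} A 1 (Suc n) w \<and> preorder w = bs))"

lemma finite_codes: "finite (codes n)"
  by (simp add: codes_def finite_trees finite_lists_length_eq)

lemma card_codes: "card (codes n) = card (trees (1::nat) n) * (card (trees (2::nat) n) * 2 ^ n)"
proof -
  have "card {bs. set bs \<subseteq> {1, 2::nat} \<and> length bs = n} = 2 ^ n"
    using card_lists_length_eq[of "{1, 2::nat}" n] by (simp add: numeral_2_eq_2)
  then show ?thesis by (simp only: codes_def card_cartesian_product)
qed

text \<open>Per column, each row tree accounts for two bits and the label word for one.\<close>

lemma card_codes_le: "n > 0 \<Longrightarrow> card (codes n) \<le> 2 ^ (5 * n)"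
proof -
  assume "n > 0"
  then have "card (codes n) \<le> 4 ^ n * (4 ^ n * 2 ^ n)"
    unfolding card_codes by (intro mult_le_mono card_trees_le order_refl)
  also have "\<dots> = (2::nat) ^ (5 * n)"
    by (simp add: power_mult flip: power_mult_distrib)
  finally show ?thesis .
qed

text \<open>Each of the two row trees costs one polynomial factor, and the label word costs none;
  hence the square.\<close>

lemma card_codes_ge:
  assumes "n > 0"
  shows "2 ^ (5 * n) \<le> (2 * real n * (real n + 1))\<^sup>2 * real (card (codes n))"
proof -
  let ?d = "2 * real n * (real n + 1)"
  have "(2::real) ^ (5 * n) = (4 ^ n * 4 ^ n) * 2 ^ n"
    by (simp add: power_mult flip: power_mult_distrib)
  also have "\<dots> \<le> ((?d * real (card (trees (1::nat) n))) * (?d * real (card (trees (2::nat) n)))) * 2 ^ n"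
    by (intro mult_right_mono mult_mono card_trees_ge[OF assms]) auto
  finally show ?thesis by (simp add: card_codes power2_eq_square mult_ac)
qed

section \<open>Query answers versus codes\<close>

lemma cells_eq: "cells n = {1, 2} \<times> {1..<Suc n}"
  by (auto simp: cells_def)

text \<open>Bridges closed ranges to the half-open intervals of \<open>cart\<close> and
  \<open>agree\<close>, which split at a column without predecessors.\<close>

lemma queries_eq:
  "queries n = {I \<times> {i..<j} | I i j. I \<in> {{1}, {2}, {1, 2}} \<and> 1 \<le> i \<and> i < j \<and> j \<le> Suc n}"
    (is "_ = ?R")
proof
  show "queries n \<subseteq> ?R"
  proof
    fix q assume "q \<in> queries n"
    then obtain i1 i2 j1 j2 where q: "q = {i1..i2} \<times> {j1..j2}"
      "1 \<le> i1" "i1 \<le> i2" "i2 \<le> 2" "1 \<le> j1" "j1 \<le> j2" "j2 \<le> n"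
      by (auto simp: queries_def)
    then have "i1 = 1 \<and> i2 = 1 \<or> i1 = 2 \<and> i2 = 2 \<or> i1 = 1 \<and> i2 = 2" by linarith
    moreover have "{1..2} = {1, 2::nat}" by auto
    ultimately have "{i1..i2} \<in> {{1}, {2}, {1, 2}}" by auto
    then show "q \<in> ?R" using q
      by (intro CollectI exI[of _ "{i1..i2}"] exI[of _ j1] exI[of _ "Suc j2"])
        (simp add: atLeastLessThanSuc_atLeastAtMost)
  qed
  show "?R \<subseteq> queries n"
  proof
    fix q assume "q \<in> ?R"
    then obtain I i j where q: "q = I \<times> {i..<j}" "I \<in> {{1}, {2}, {1, 2}}"
      "1 \<le> i" "i < j" "j \<le> Suc n" by blast
    from q(2) have "\<exists>a b. I = {a..b} \<and> 1 \<le> a \<and> a \<le> b \<and> b \<le> 2"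
    proof (elim insertE)
      assume "I = {1}"
      then show ?thesis by (intro exI[of _ 1]) simp
    next
      assume "I = {2}"
      then show ?thesis by (intro exI[of _ 2]) simp
    next
      assume "I = {1, 2}"
      moreover have "{1..2} = {1, 2::nat}" by auto
      ultimately show ?thesis by (intro exI[of _ 1] exI[of _ 2]) simp
    qed simp
    then obtain a b where "I = {a..b}" "1 \<le> a" "a \<le> b" "b \<le> 2" by blast
    moreover have "{i..<j} = {i..j - 1}" "i \<le> j - 1" "j - 1 \<le> n" using q by auto
    ultimately show "q \<in> queries n" using q(1,3) unfolding queries_def
      by (intro CollectI exI[of _ a] exI[of _ b] exI[of _ i] exI[of _ "j - 1"]) simp
  qed
qed

lemma smax_iff_rmq:
  assumes "A \<in> arrays n" "q \<in> queries n"
  shows "smax A q p \<longleftrightarrow> p = rmq A q"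
proof -
  obtain I i j where I: "q = I \<times> {i..<j}" "I \<in> {{1}, {2}, {1, 2}}"
    "1 \<le> i" "i < j" "j \<le> Suc n" using assms(2) unfolding queries_eq by blast
  from I(2) have "finite I" "I \<noteq> {}" "I \<subseteq> {1, 2}" by auto
  then have q: "finite q" "q \<noteq> {}" "q \<subseteq> cells n"
    using I(3-5) unfolding cells_eq I(1) by (simp_all add: Sigma_mono)
  have inj: "inj_on A q"
    using assms(1) inj_on_subset[of A, OF _ q(3)] by (simp add: arrays_def)
  have *: "rmq A q = p" if "smax A q p" for p
    unfolding rmq_def arg_max_on_def
  proof (rule arg_maxI)
    show "p \<in> q" using that by (simp add: smax_def)
    show "\<not> A p < A y" if "y \<in> q" for y
      using \<open>smax A q p\<close> that unfolding smax_def by (metis order_less_asym order_less_irrefl)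
    show "x = p" if "x \<in> q" "\<forall>y. y \<in> q \<longrightarrow> \<not> A x < A y" for x
      using \<open>smax A q p\<close> that unfolding smax_def by metis
  qed
  obtain p0 where p0: "smax A q p0" using smax_exists[OF q(1,2) inj] by blast
  then have "rmq A q = p0" by (rule *)
  then show ?thesis using p0 smax_unique by metis
qed

lemma rmq_eq_iff_agree:
  assumes "A \<in> arrays n" "B \<in> arrays n"
  shows "(\<forall>q\<in>queries n. rmq A q = rmq B q) \<longleftrightarrow>
    (\<forall>I\<in>{{1}, {2}, {1, 2}}. agree I A B 1 (Suc n))" (is "?L \<longleftrightarrow> ?R")
proof
  assume L: ?L
  show ?R
    unfolding agree_def
  proof (intro ballI allI impI)
    fix I :: "nat set" and i j :: nat and p
    assume I: "I \<in> {{1::nat}, {2}, {1, 2}}" and ij: "1 \<le> i" "j \<le> Suc n"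
    \<comment> \<open>An empty interval is not a query, but there \<open>smax\<close> fails for both
      arrays.\<close>
    show "smax A (I \<times> {i..<j}) p = smax B (I \<times> {i..<j}) p"
    proof (cases "i < j")
      case True
      then have "I \<times> {i..<j} \<in> queries n" unfolding queries_eq using I ij by blast
      then show ?thesis using L smax_iff_rmq[OF assms(1)] smax_iff_rmq[OF assms(2)] by simp
    qed (simp add: smax_def)
  qed
next
  assume R: ?R
  show ?L
  proof
    fix q assume q: "q \<in> queries n"
    then obtain I i j where I: "q = I \<times> {i..<j}" "I \<in> {{1}, {2}, {1, 2}}"
      "1 \<le> i" "j \<le> Suc n" unfolding queries_eq by blast
    then have "smax A q (rmq A q) = smax B q (rmq A q)"
      using R unfolding agree_def by blast
    then show "rmq A q = rmq B q"
      using smax_iff_rmq[OF assms(1) q] smax_iff_rmq[OF assms(2) q] by simp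
  qed
qed

lemma has_code_exists:
  assumes "A \<in> arrays n"
  shows "\<exists>c\<in>codes n. has_code n A c"
proof -
  have *: "\<exists>t. cart I A 1 (Suc n) t \<and> size t = n \<and> set_tree t \<subseteq> I" if "I \<in> {{1}, {2}, {1, 2}}" for I
  proof -
    have I: "finite I" "I \<noteq> {}" "I \<times> {1..<Suc n} \<subseteq> cells n"
      using that by (auto simp: cells_eq)
    have "inj_on A (I \<times> {1..<Suc n})"
      using assms inj_on_subset[of A, OF _ I(3)] by (simp add: arrays_def)
    then have "\<exists>t. cart I A 1 (Suc n) t"
      using I by (intro cart_exists) simp_all
    then show ?thesis using cart_size by (metis diff_Suc_1)
  qed
  obtain t u w where
    "cart {1} A 1 (Suc n) t" "size t = n" "set_tree t \<subseteq> {1}"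
    "cart {2} A 1 (Suc n) u" "size u = n" "set_tree u \<subseteq> {2}"
    "cart {1, 2} A 1 (Suc n) w" "size w = n" "set_tree w \<subseteq> {1, 2}"
    using *[of "{1}"] *[of "{2}"] *[of "{1, 2}"] by auto
  then show ?thesis
    by (intro bexI[of _ "(t, u, preorder w)"]) (auto simp: has_code_def codes_def trees_def)
qed

text \<open>Decoding rests on this: equal row trees make the rows agree, and then equal label words
  make both rows together agree.\<close>

lemma has_code_imp_rmq_eq:
  assumes "A \<in> arrays n" "B \<in> arrays n" "has_code n A c" "has_code n B c" "q \<in> queries n"
  shows "rmq A q = rmq B q"
proof -
  obtain t u v w where
    r: "cart {1} A 1 (Suc n) t" "cart {1} B 1 (Suc n) t"
      "cart {2} A 1 (Suc n) u" "cart {2} B 1 (Suc n) u"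
    and j: "cart {1, 2} A 1 (Suc n) v" "cart {1, 2} B 1 (Suc n) w" "preorder v = preorder w"
    using assms(3,4) unfolding has_code_def by (auto split: prod.splits)
  have "agree {1} A B 1 (Suc n)" "agree {2} A B 1 (Suc n)"
    using cart_imp_agree r by blast+
  moreover from this have "agree {1, 2} A B 1 (Suc n)"
    by (intro cart_preorder_agree[OF j]) auto
  ultimately have "\<forall>q\<in>queries n. rmq A q = rmq B q"
    by (subst rmq_eq_iff_agree[OF assms(1,2)]) simp
  then show ?thesis using assms(5) by blast
qed

text \<open>For the lower bound: with uniqueness of codes, arrays with different codes must differ
  in some answer.\<close>

lemma has_code_agree:
  assumes "has_code n A c" "\<forall>I\<in>{{1}, {2}, {1, 2}}. agree I A B 1 (Suc n)"
  shows "has_code n B c"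
  using assms cart_agree unfolding has_code_def by (fastforce split: prod.splits)

lemma has_code_unique:
  assumes "has_code n A c" "has_code n A d"
  shows "c = d"
  using assms unfolding has_code_def by (auto split: prod.splits dest: cart_unique)

text \<open>Carries the integer constructions over to any infinite linear order: each element goes
  to the element of the same rank in a set of equal size.\<close>

lemma strict_mono_on_embedding:
  fixes S :: "'b::linorder set"
  assumes "infinite (UNIV :: 'a::linorder set)" "finite S"
  shows "\<exists>f :: 'b \<Rightarrow> 'a. strict_mono_on S f"
proof -
  obtain T :: "'a set" where T: "finite T" "card T = card S"
    using infinite_arbitrarily_large[OF assms(1)] by blast
  define f where "f x = sorted_list_of_set T ! card {y \<in> S. y < x}" for x
  have "f x < f y" if "x \<in> S" "y \<in> S" "x < y" for x y
  proof -
    have "card {z \<in> S. z < x} < card {z \<in> S. z < y}"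
      using that assms(2) by (intro psubset_card_mono) auto
    moreover have "card {z \<in> S. z < y} < card S"
      using that assms(2) by (intro psubset_card_mono) auto
    ultimately show ?thesis
      unfolding f_def using T by (intro sorted_wrt_nth_less[of "(<)"]) auto
  qed
  then show ?thesis by (auto simp: strict_mono_on_def)
qed

lemma code_realizable:
  assumes "infinite (UNIV :: 'a::linorder set)" "c \<in> codes n"
  shows "\<exists>A\<in>arrays n. has_code n (A :: nat \<times> nat \<Rightarrow> 'a) c"
proof -
  obtain t u bs where c: "c = (t, u, bs)" "size t = n" "set_tree t \<subseteq> {1}"
    "size u = n" "set_tree u \<subseteq> {2}" "set bs \<subseteq> {1, 2}" "length bs = n"
    using assms(2) by (auto simp: codes_def trees_def)
  obtain C1 :: "nat \<times> nat \<Rightarrow> int" where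
    C1: "inj_on C1 ({1} \<times> {1..<Suc n})" "cart {1} C1 1 (Suc n) t"
    using cart_row_realizable[OF c(3), of 1] unfolding c(2) plus_1_eq_Suc by blast
  obtain C2 :: "nat \<times> nat \<Rightarrow> int" where
    C2: "inj_on C2 ({2} \<times> {1..<Suc n})" "cart {2} C2 1 (Suc n) u"
    using cart_row_realizable[OF c(5), of 1] unfolding c(4) plus_1_eq_Suc by blast
  \<comment> \<open>The rows are realized separately and merely put side by side; comparisons
    between them are settled by \<open>cart_realizable\<close>.\<close>
  define C where "C p = (if fst p = 1 then C1 p else C2 p)" for p
  have "agree {1} C1 C 1 (Suc n)" "agree {2} C2 C 1 (Suc n)"
    by (auto intro!: agree_mono simp: C_def)
  then have C: "cart {1} C 1 (Suc n) t" "cart {2} C 1 (Suc n) u"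
    using C1(2) C2(2) cart_agree by blast+
  have "inj_on C ({1} \<times> {1..<Suc n})"
    using C1(1) by (subst inj_on_cong[of _ C C1]) (auto simp: C_def)
  moreover have "inj_on C ({2} \<times> {1..<Suc n})"
    using C2(1) by (subst inj_on_cong[of _ C C2]) (auto simp: C_def)
  ultimately have inj: "inj_on C ({x} \<times> {1..<Suc n})" if "x \<in> {1, 2}" for x
    using that by blast
  have "\<exists>(A :: nat \<times> nat \<Rightarrow> int) w. inj_on A ({1, 2} \<times> {1..<Suc n}) \<and>
      (\<forall>x\<in>{1, 2}. agree {x} A C 1 (Suc n)) \<and> cart {1, 2} A 1 (Suc n) w \<and> preorder w = bs"
    by (rule cart_realizable[OF _ _ _ c(6) inj]) (simp_all add: c(7))
  then obtain A :: "nat \<times> nat \<Rightarrow> int" and w where A: "inj_on A ({1, 2} \<times> {1..<Suc n})"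
    "\<forall>x\<in>{1, 2}. agree {x} A C 1 (Suc n)" "cart {1, 2} A 1 (Suc n) w" "preorder w = bs"
    by blast
  have "agree {1} C A 1 (Suc n)" "agree {2} C A 1 (Suc n)"
    using A(2) agree_sym by blast+
  then have "cart {1} A 1 (Suc n) t" "cart {2} A 1 (Suc n) u"
    using C cart_agree by blast+
  then have A_code: "has_code n A c" using A(3,4) c by (auto simp: has_code_def)
  have "finite (A ` cells n)" by (simp add: cells_def)
  then obtain f :: "int \<Rightarrow> 'a" where f: "strict_mono_on (A ` cells n) f"
    using strict_mono_on_embedding[OF assms(1)] by blast
  \<comment> \<open>An increasing change of values keeps the code; the restriction makes the array
    extensional.\<close>
  define B where "B = restrict (\<lambda>p. f (A p)) (cells n)"
  have less: "A p < A q \<longleftrightarrow> B p < B q" if "p \<in> cells n" "q \<in> cells n" for p q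
    using that f unfolding B_def by (simp add: strict_mono_on_less)
  have "inj_on B (cells n)"
    using A(1) less unfolding cells_eq[symmetric] inj_on_def by (metis linorder_neq_iff)
  then have "B \<in> arrays n" by (simp add: arrays_def B_def)
  moreover have "agree I A B 1 (Suc n)" if "I \<in> {{1}, {2}, {1, 2}}" for I
    using that by (intro agree_mono less) (auto simp: cells_eq)
  then have "has_code n B c" using has_code_agree[OF A_code] by blast
  ultimately show ?thesis by blast
qed

section \<open>Upper and lower bounds for encodings\<close>

lemma encoding_exists:
  assumes "n > 0"
  shows "\<exists>enc :: (nat \<times> nat \<Rightarrow> 'a::linorder) \<Rightarrow> bool list.
    rmq_encoding n enc \<and> (\<forall>A\<in>arrays n. length (enc A) = 5 * n)"
proof -
  define L where "L = {bs :: bool list. length bs = 5 * n}"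
  have L: "finite L" "card L = 2 ^ (5 * n)"
    using finite_lists_length_eq[of "UNIV :: bool set" "5 * n"]
      card_lists_length_eq[of "UNIV :: bool set" "5 * n"] by (simp_all add: L_def)
  obtain h where h: "h ` codes n \<subseteq> L" "inj_on h (codes n)"
    using card_le_inj[OF finite_codes L(1), of n] card_codes_le[OF assms] L(2) by auto
  have "\<forall>A\<in>arrays n. \<exists>c. c \<in> codes n \<and> has_code n (A :: nat \<times> nat \<Rightarrow> 'a) c"
    using has_code_exists by blast
  then have "\<exists>code. \<forall>A\<in>arrays n. code A \<in> codes n \<and> has_code n (A :: nat \<times> nat \<Rightarrow> 'a) (code A)"
    by (rule bchoice)
  then obtain code where
    code: "\<And>A :: nat \<times> nat \<Rightarrow> 'a. A \<in> arrays n \<Longrightarrow> code A \<in> codes n \<and> has_code n A (code A)"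
    by blast
  define enc where "enc A = h (code A)" for A
  \<comment> \<open>The decoder answers from any array with the given bit string. It need not be the
    original one, but injectivity of \<open>h\<close> gives it the same code and hence the same
    answers.\<close>
  define dec where "dec bs = rmq (SOME A. A \<in> arrays n \<and> enc A = bs)" for bs
  have "dec (enc A) q = rmq A q" if A: "A \<in> arrays n" and q: "q \<in> queries n" for A q
  proof -
    define B where "B = (SOME B. B \<in> arrays n \<and> enc B = enc A)"
    have B: "B \<in> arrays n \<and> enc B = enc A"
      unfolding B_def using A by (intro someI[of "\<lambda>B. B \<in> arrays n \<and> enc B = enc A"]) simp
    then have "code B = code A" using h(2) code A unfolding enc_def by (metis inj_onD)
    then have "rmq B q = rmq A q"
      using has_code_imp_rmq_eq code A B q by metis
    then show ?thesis by (simp add: dec_def B_def)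
  qed
  then have "rmq_encoding n enc" unfolding rmq_encoding_def by blast
  moreover have "length (enc A) = 5 * n" if "A \<in> arrays n" for A
    using h(1) code[OF that] by (auto simp: enc_def L_def)
  ultimately show ?thesis by blast
qed

text \<open>Representatives of different codes need different bit strings. Lengths may vary and no
  prefix property is assumed, so all strings of length at most the maximum are counted; this causes
  the \<open>+ 1\<close>.\<close>

lemma encoding_long:
  fixes enc :: "(nat \<times> nat \<Rightarrow> 'a::linorder) \<Rightarrow> bool list"
  assumes "infinite (UNIV :: 'a set)" "n > 0" "rmq_encoding n enc"
  shows "\<exists>A\<in>arrays n. card (codes n) \<le> 2 ^ (length (enc A) + 1)"
proof -
  have "\<forall>c\<in>codes n. \<exists>A. A \<in> arrays n \<and> has_code n (A :: nat \<times> nat \<Rightarrow> 'a) c"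
    using code_realizable[OF assms(1)] by blast
  then obtain rep :: "nat tree \<times> nat tree \<times> nat list \<Rightarrow> nat \<times> nat \<Rightarrow> 'a" where
    rep: "\<And>c. c \<in> codes n \<Longrightarrow> rep c \<in> arrays n \<and> has_code n (rep c) c"
    by (auto dest!: bchoice)
  have inj: "inj_on (\<lambda>c. enc (rep c)) (codes n)"
  proof (rule inj_onI)
    fix c d assume cd: "c \<in> codes n" "d \<in> codes n" "enc (rep c) = enc (rep d)"
    then have "\<forall>q\<in>queries n. rmq (rep c) q = rmq (rep d) q"
      using assms(3) rep unfolding rmq_encoding_def by metis
    then have "\<forall>I\<in>{{1}, {2}, {1, 2}}. agree I (rep c) (rep d) 1 (Suc n)"
      using rmq_eq_iff_agree rep cd by blast
    then show "c = d" using has_code_agree has_code_unique rep cd by metis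
  qed
  \<comment> \<open>The maximal length is attained only if some code exists, which the lower bound
    on their number provides.\<close>
  have "0 < card (codes n)"
  proof (rule ccontr)
    assume "\<not> 0 < card (codes n)"
    then have "(2::real) ^ (5 * n) \<le> 0" using card_codes_ge[OF assms(2)] by simp
    then show False using zero_less_power[of "2::real" "5 * n"] by linarith
  qed
  then have ne: "codes n \<noteq> {}" by auto
  define M where "M = Max ((\<lambda>c. length (enc (rep c))) ` codes n)"
  have "M \<in> (\<lambda>c. length (enc (rep c))) ` codes n"
    unfolding M_def using ne finite_codes by (intro Max_in) auto
  then obtain c where c: "c \<in> codes n" "M = length (enc (rep c))" by auto
  let ?L = "{bs :: bool list. set bs \<subseteq> UNIV \<and> length bs \<le> M}"
  have "(\<lambda>c. enc (rep c)) ` codes n \<subseteq> ?L"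
    unfolding M_def using finite_codes by auto
  then have "card (codes n) \<le> card ?L"
    using finite_lists_length_le[of "UNIV :: bool set" M] by (intro card_inj_on_le[OF inj]) auto
  also have "\<dots> = (\<Sum>k\<le>M. 2 ^ k)" by (subst card_lists_length_le) auto
  also have "\<dots> = 2 ^ (M + 1) - 1"
    by (induction M) auto
  finally have "card (codes n) \<le> 2 ^ (M + 1)" by linarith
  then show ?thesis using c rep by blast
qed

theorem corollary1:
  assumes "infinite (UNIV :: 'a::linorder set)"
  shows "\<exists>f g :: nat \<Rightarrow> real. nonneg_O_log f \<and> nonneg_O_log g \<and>
    (\<forall>n\<ge>2.
      (\<forall>enc :: (nat \<times> nat \<Rightarrow> 'a) \<Rightarrow> bool list. rmq_encoding n enc \<longrightarrow>
         (\<exists>A\<in>arrays n. 5 * real n - f n \<le> real (length (enc A)))) \<and>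
      (\<exists>enc :: (nat \<times> nat \<Rightarrow> 'a) \<Rightarrow> bool list. rmq_encoding n enc \<and>
         (\<forall>A\<in>arrays n. real (length (enc A)) \<le> 5 * real n - g n)))"
proof -
  \<comment> \<open>For \<open>n >= 2\<close>, \<open>2 * n * (n + 1) <= n ^ 4\<close>, so the
    squared loss is at most \<open>n ^ 8\<close>; one more factor \<open>n\<close> absorbs the 2
    from counting shorter strings. The exponent 9 becomes the constant.\<close>
  define f where "f n = 9 * log 2 (real n)" for n
  have "nonneg_O_log f"
    unfolding nonneg_O_log_def f_def by (intro exI[of _ 9]) simp
  \<comment> \<open>The second error term is zero: \<open>5 * n\<close> bits hold every code, and
    zero is a nonnegative multiple of the logarithm.\<close>
  moreover have "nonneg_O_log (\<lambda>_. 0)"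
    unfolding nonneg_O_log_def by (intro exI[of _ 0]) simp
  moreover have "\<exists>A\<in>arrays n. 5 * real n - f n \<le> real (length (enc A))"
    if n: "n \<ge> 2" and enc: "rmq_encoding n enc" for n and enc :: "(nat \<times> nat \<Rightarrow> 'a) \<Rightarrow> bool list"
  proof -
    obtain A where A: "A \<in> arrays n" "card (codes n) \<le> 2 ^ (length (enc A) + 1)"
      using encoding_long[OF assms _ enc] n by auto
    have pos: "0 < real n" using n by simp
    have "2 * real n * (real n + 1) \<le> real n * real n * (real n * real n)"
    proof (rule mult_mono)
      have "real n + real n \<le> real n * real n" using n by (simp add: mult_right_mono flip: mult_2)
      then show "real n + 1 \<le> real n * real n" using n by linarith
    qed (use n in \<open>auto intro: mult_right_mono\<close>)
    then have d: "2 * real n * (real n + 1) \<le> real n ^ 4" by (simp add: power4_eq_xxxx)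
    have "(2::real) ^ (5 * n) \<le> (2 * real n * (real n + 1))\<^sup>2 * real (card (codes n))"
      using card_codes_ge[of n] n by simp
    also have "\<dots> \<le> (real n ^ 4)\<^sup>2 * 2 ^ (length (enc A) + 1)"
    proof (rule mult_mono)
      show "(2 * real n * (real n + 1))\<^sup>2 \<le> (real n ^ 4)\<^sup>2" using d by (intro power_mono) auto
      show "real (card (codes n)) \<le> 2 ^ (length (enc A) + 1)"
        using A(2) by (metis of_nat_le_iff of_nat_numeral of_nat_power)
    qed auto
    also have "\<dots> = 2 * (real n ^ 8 * 2 ^ length (enc A))" by simp
    also have "\<dots> \<le> real n * (real n ^ 8 * 2 ^ length (enc A))"
      using n by (intro mult_right_mono) auto
    also have "\<dots> = real n ^ 9 * 2 ^ length (enc A)" by (simp add: eval_nat_numeral)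
    finally have "log 2 (2 ^ (5 * n)) \<le> log 2 (real n ^ 9 * 2 ^ length (enc A))"
      using pos by (subst log_le_cancel_iff) auto
    then have "5 * real n \<le> 9 * log 2 (real n) + real (length (enc A))"
      using pos by (simp add: log_mult log_nat_power)
    then show ?thesis using A(1) unfolding f_def by (intro bexI[of _ A]) auto
  qed
  moreover have "\<exists>enc :: (nat \<times> nat \<Rightarrow> 'a) \<Rightarrow> bool list. rmq_encoding n enc \<and>
      (\<forall>A\<in>arrays n. real (length (enc A)) \<le> 5 * real n - 0)" if "n \<ge> 2" for n
  proof -
    have "0 < n" using that by simp
    then obtain enc :: "(nat \<times> nat \<Rightarrow> 'a) \<Rightarrow> bool list" where
      "rmq_encoding n enc" "\<forall>A\<in>arrays n. length (enc A) = 5 * n"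
      using encoding_exists by blast
    then show ?thesis by (intro exI[of _ enc]) simp
  qed
  ultimately show ?thesis by blast
qed

end
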